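(* A map $\varepsilon\colon X^{\times}_{\mathrm{irr}}\to\mathcal{P}(M)$ is a Fitch map if and only if for all (not necessarily distinct) colors $m,m'\in M$: (I) for every 3-element subset $\{a,b,c\}\subseteq X$ with $m\in\varepsilon(c,b)$ and $m\notin\varepsilon(a,b)$ we have (1) $m\in\varepsilon(c,a)$, (2) $m'\in\varepsilon(a,c)$ if and only if $m'\in\varepsilon(b,c)$, and (3) if $m\neq m'$ and $m'\notin\varepsilon(c,b)$ then $m'\notin\varepsilon(a,b)$; and (II) for every 4-element subset $\{a,b,c,d\}\subseteq X$ with $m\in\varepsilon(c,b)$ and $m\notin\varepsilon(a,b)$ we have (4) if $m\neq m'$ and $m'\notin\varepsilon(b,d)\cup\varepsilon(c,d)$, then $m'\notin\varepsilon(a,d)$.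
   Context: $X$ is a finite nonempty set, $M$ a finite nonempty set of colors, $X^{\times}_{\mathrm{irr}}=\{(x,y)\in X\times X: x\neq y\}$. A phylogenetic tree on $X$ is a rooted tree whose leaves (non-root vertices of degree $1$) form $X$, whose root has degree $\ge2$ and whose non-root inner vertices have degree $\ge3$; $\mathrm{lca}(x,y)$ is the last common ancestor. An edge-labeled tree $(T,\lambda)$ on $X$ with $M$ is a phylogenetic tree $T$ on $X$ with $\lambda\colon E(T)\to\mathcal{P}(M)$; $e$ is an $m$-edge if $m\in\lambda(e)$. $(T,\lambda)$ explains $\varepsilon$ if for all $(x,y)\in X^{\times}_{\mathrm{irr}}$, $m\in M$: $m\in\varepsilon(x,y)$ iff the path from $\mathrm{lca}(x,y)$ to $y$ contains an $m$-edge; $\varepsilon$ is a Fitch map if some edge-labeled tree explains it.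
   Formalization: For a one-element X no tree has root of degree at least 2, so the stated equivalence would fail there; the formal version also counts the one-vertex tree as a phylogenetic tree on a single-element X. For at least two elements the definition is unchanged. *)

theory Defs
  imports "Graph_Theory.Pair_Digraph" "HOL-Library.FuncSet"
begin

text \<open>
  A rooted tree is represented with its edges directed away from the root: every vertex is the
  end of exactly one walk that starts at the root. (The predicate \<open>tree\<close> of
  \<open>Graph_Theory.Digraph_Component\<close> only excludes directed cycles and is not usable here.)
\<close>

definition rooted_tree :: "'v pair_pre_digraph \<Rightarrow> 'v \<Rightarrow> bool" where
  "rooted_tree T r \<longleftrightarrow>
     pair_fin_digraph T \<and> r \<in> pverts T \<and>
     (\<forall>v \<in> pverts T. \<exists>!p. pre_digraph.awalk (with_proj T) r p v)"

definition degree :: "'v pair_pre_digraph \<Rightarrow> 'v \<Rightarrow> nat" where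
  "degree T v = in_degree (with_proj T) v + out_degree (with_proj T) v"

definition leaves :: "'v pair_pre_digraph \<Rightarrow> 'v \<Rightarrow> 'v set" where
  "leaves T r = {v \<in> pverts T. v \<noteq> r \<and> degree T v = 1}"

text \<open>
  The first disjunct is the usual convention for one taxon: the one-vertex tree is a
  phylogenetic tree on that taxon. It only concerns singletons \<open>L\<close>, for which the degree
  conditions of the second disjunct cannot be satisfied by any tree.
\<close>

definition phylogenetic_tree :: "'v pair_pre_digraph \<Rightarrow> 'v \<Rightarrow> 'v set \<Rightarrow> bool" where
  "phylogenetic_tree T r L \<longleftrightarrow>
     rooted_tree T r \<and>
     (pverts T = {r} \<and> L = {r} \<or>
      leaves T r = L \<and> 2 \<le> degree T r \<and>
      (\<forall>v \<in> pverts T - leaves T r - {r}. 3 \<le> degree T v))"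

definition common_ancestor :: "'v pair_pre_digraph \<Rightarrow> 'v \<Rightarrow> 'v \<Rightarrow> 'v \<Rightarrow> bool" where
  "common_ancestor T x y u \<longleftrightarrow> u \<rightarrow>\<^sup>*\<^bsub>with_proj T\<^esub> x \<and> u \<rightarrow>\<^sup>*\<^bsub>with_proj T\<^esub> y"

definition lca :: "'v pair_pre_digraph \<Rightarrow> 'v \<Rightarrow> 'v \<Rightarrow> 'v" where
  "lca T x y = (THE u. common_ancestor T x y u \<and>
     (\<forall>w. common_ancestor T x y w \<longrightarrow> w \<rightarrow>\<^sup>*\<^bsub>with_proj T\<^esub> u))"

definition edge_labeled_tree ::
  "'v pair_pre_digraph \<Rightarrow> 'v \<Rightarrow> ('v \<times> 'v \<Rightarrow> 'c set) \<Rightarrow> 'v set \<Rightarrow> 'c set \<Rightarrow> bool" where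
  "edge_labeled_tree T r lam L M \<longleftrightarrow>
     phylogenetic_tree T r L \<and> lam \<in> parcs T \<rightarrow> Pow M"

definition irr_pairs :: "'a set \<Rightarrow> ('a \<times> 'a) set" where
  "irr_pairs X = {(x, y) \<in> X \<times> X. x \<noteq> y}"

text \<open>
  Vertices are taken from \<open>'a + nat\<close>, with the element \<open>x\<close> of \<open>X\<close> identified with the leaf
  \<open>Inl x\<close>. Since trees are finite, every tree with leaf set \<open>X\<close> is, up to renaming of its
  inner vertices, of this form, even if \<open>X\<close> exhausts the type \<open>'a\<close>.
\<close>

definition explains ::
  "('a + nat) pair_pre_digraph \<Rightarrow> (('a + nat) \<times> ('a + nat) \<Rightarrow> 'c set) \<Rightarrow>
   'a set \<Rightarrow> 'c set \<Rightarrow> ('a \<times> 'a \<Rightarrow> 'c set) \<Rightarrow> bool" where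
  "explains T lam X M \<epsilon> \<longleftrightarrow>
     (\<forall>(x, y) \<in> irr_pairs X. \<forall>m \<in> M.
        m \<in> \<epsilon> (x, y) \<longleftrightarrow>
        (\<exists>p. pre_digraph.apath (with_proj T) (lca T (Inl x) (Inl y)) p (Inl y) \<and>
             (\<exists>e \<in> set p. m \<in> lam e)))"

definition fitch_map :: "'a set \<Rightarrow> 'c set \<Rightarrow> ('a \<times> 'a \<Rightarrow> 'c set) \<Rightarrow> bool" where
  "fitch_map X M \<epsilon> \<longleftrightarrow>
     (\<exists>T r lam. edge_labeled_tree T r lam (Inl ` X) M \<and> explains T lam X M \<epsilon>)"

end

theory Submission
  imports Defs
begin

text \<open>
  Let \<open>N\<^sub>m(y)\<close> consist of \<open>y\<close> and all \<open>x\<close> with \<open>m \<notin> \<epsilon> (x, y)\<close>. In a tree that explains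
  \<open>\<epsilon>\<close>, a leaf \<open>x\<close> lies in \<open>N\<^sub>m(y)\<close> iff every \<open>m\<close>-edge above \<open>y\<close> is also above \<open>x\<close>. Hence
  \<open>x \<in> N\<^sub>m(y)\<close> implies \<open>N\<^sub>m(x) \<subseteq> N\<^sub>m(y)\<close>, and no two of these sets, of whatever colors, overlap.
  Conversely, if both properties hold, then the sets \<open>N\<^sub>m(y)\<close> together with \<open>X\<close> and the singletons
  form a hierarchy, and its tree, with color \<open>m\<close> on the edge entering \<open>N\<^sub>m(y)\<close>, explains \<open>\<epsilon>\<close>.
  Condition (1) says that the sets of one color are nested in this sense, and given (1), conditions
  (2)--(4) say that no overlap occurs: (2) excludes it if neither set contains the center of the
  other one, or if the center of the one set is the element missing from the other, (3) if the
  centers agree, and (4) in the remaining case.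
\<close>

section \<open>Ancestors in rooted trees\<close>

locale rooted = pair_fin_digraph T for T :: "'v pair_pre_digraph" +
  fixes r :: 'v
  assumes root_in_verts: "r \<in> pverts T"
    and ex1_root_walk: "v \<in> pverts T \<Longrightarrow> \<exists>!p. awalk r p v"
begin

lemma root_walkE:
  assumes "v \<in> pverts T"
  obtains p where "awalk r p v"
  using ex1_root_walk[OF assms] by blast

lemma awalk_unique:
  assumes "awalk u p v" "awalk u q v"
  shows "p = q"
proof -
  have "u \<in> pverts T" "v \<in> pverts T"
    using assms(1) awalk_hd_in_verts awalk_last_in_verts by auto
  then obtain s where "awalk r s u"
    by (meson root_walkE)
  then have "awalk r (s @ p) v" "awalk r (s @ q) v"
    using assms by (auto intro: awalk_appendI)
  then have "s @ p = s @ q"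
    using ex1_root_walk[OF \<open>v \<in> pverts T\<close>] by blast
  then show ?thesis by simp
qed

lemma awalk_imp_apath:
  assumes "awalk u p v"
  shows "apath u p v"
proof -
  have "apath u (awalk_to_apath p) v"
    using assms by (rule apath_awalk_to_apath)
  then show ?thesis
    using awalk_unique[OF assms] awalkI_apath by metis
qed

lemma ancestors_chain:
  assumes "u \<rightarrow>\<^sup>*\<^bsub>with_proj T\<^esub> x" "w \<rightarrow>\<^sup>*\<^bsub>with_proj T\<^esub> x"
  shows "u \<rightarrow>\<^sup>*\<^bsub>with_proj T\<^esub> w \<or> w \<rightarrow>\<^sup>*\<^bsub>with_proj T\<^esub> u"
proof -
  obtain p' q' where p': "awalk u p' x" and q': "awalk w q' x"
    using assms reachable_awalk by auto
  obtain p where p: "awalk r p u"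
    using awalk_hd_in_verts[OF p'] root_walkE by blast
  obtain q where q: "awalk r q w"
    using awalk_hd_in_verts[OF q'] root_walkE by blast
  have "p @ p' = q @ q'"
    using p p' q q' by (intro awalk_unique[of r _ x]) (auto intro: awalk_appendI)
  then obtain s where "p = q @ s \<or> q = p @ s"
    by (auto simp: append_eq_append_conv2)
  then show ?thesis
  proof
    assume "p = q @ s"
    with p obtain w' where w': "awalk r q w'" "awalk w' s u"
      by auto
    then have "w' = w"
      using q awalk_ends by blast
    with w' have "awalk w s u" by simp
    then show ?thesis by (auto intro: reachable_awalkI)
  next
    assume "q = p @ s"
    with q obtain u' where u': "awalk r p u'" "awalk u' s w"
      by auto
    then have "u' = u"
      using p awalk_ends by blast
    with u' have "awalk u s w" by simp
    then show ?thesis by (auto intro: reachable_awalkI)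
  qed
qed

lemma reachable_antisym:
  assumes "u \<rightarrow>\<^sup>*\<^bsub>with_proj T\<^esub> v" "v \<rightarrow>\<^sup>*\<^bsub>with_proj T\<^esub> u"
  shows "u = v"
proof -
  obtain p q where p: "awalk u p v" and q: "awalk v q u"
    using assms reachable_awalk by auto
  have "p @ q = []"
    using p q awalk_hd_in_verts[OF p]
    by (intro awalk_unique[of u _ u]) (auto intro: awalk_appendI simp: awalk_Nil_iff)
  then show ?thesis
    using p by (simp add: awalk_Nil_iff)
qed

lemma parent_unique:
  assumes "(u, v) \<in> parcs T" "(w, v) \<in> parcs T"
  shows "u = w"
proof -
  have "u \<in> pverts T" "w \<in> pverts T"
    using assms in_arcsD1 by auto
  then obtain p q where "awalk r p u" "awalk r q w"
    by (meson root_walkE)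
  moreover have "awalk u [(u, v)] v" "awalk w [(w, v)] v"
    using assms in_arcsD1 in_arcsD2 by (auto simp: awalk_simps)
  ultimately have "p @ [(u, v)] = q @ [(w, v)]"
    by (intro awalk_unique[of r _ v]) (blast intro: awalk_appendI)+
  then show ?thesis by simp
qed

lemma reachable_parent:
  assumes "w \<rightarrow>\<^sup>*\<^bsub>with_proj T\<^esub> v" "w \<noteq> v" "(u, v) \<in> parcs T"
  shows "w \<rightarrow>\<^sup>*\<^bsub>with_proj T\<^esub> u"
proof -
  obtain p where p: "awalk w p v"
    using assms(1) reachable_awalk by auto
  then have "p \<noteq> []"
    using assms(2) by (auto simp: awalk_Nil_iff)
  then obtain q e where "p = q @ [e]"
    by (metis rev_exhaust)
  with p obtain u' where q: "awalk w q u'" and "awalk u' [e] v"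
    by auto
  then have "e = (u', v)" "e \<in> parcs T"
    by (auto simp: awalk_simps prod_eq_iff)
  then have "u' = u"
    using parent_unique assms(3) by blast
  with q show ?thesis by (auto intro: reachable_awalkI)
qed

lemma ex_last_common_ancestor:
  assumes "x \<in> pverts T" "y \<in> pverts T"
  shows "\<exists>u. common_ancestor T x y u \<and>
    (\<forall>w. common_ancestor T x y w \<longrightarrow> w \<rightarrow>\<^sup>*\<^bsub>with_proj T\<^esub> u)"
proof -
  let ?C = "{u. common_ancestor T x y u}"
  let ?d = "\<lambda>u. card {w. w \<rightarrow>\<^sup>*\<^bsub>with_proj T\<^esub> u}"
  have sub: "{w. w \<rightarrow>\<^sup>*\<^bsub>with_proj T\<^esub> u} \<subseteq> pverts T" for u
    using reachable_in_verts by auto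
  then have fin: "finite {w. w \<rightarrow>\<^sup>*\<^bsub>with_proj T\<^esub> u}" for u
    using pair_finite_verts finite_subset by blast
  have "?C \<subseteq> {w. w \<rightarrow>\<^sup>*\<^bsub>with_proj T\<^esub> x}"
    by (auto simp: common_ancestor_def)
  then have finC: "finite ?C"
    using fin finite_subset by blast
  have "r \<in> ?C"
    using assms by (auto simp: common_ancestor_def reachable_awalk elim!: root_walkE)
  then have "Max (?d ` ?C) \<in> ?d ` ?C"
    using finC by (intro Max_in) auto
  then obtain u where u: "u \<in> ?C" and "?d u = Max (?d ` ?C)"
    by (metis (no_types, lifting) imageE)
  then have max: "?d w \<le> ?d u" if "w \<in> ?C" for w
    using finC that by simp
  have "w \<rightarrow>\<^sup>*\<^bsub>with_proj T\<^esub> u" if "w \<in> ?C" for w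
  proof (rule ccontr)
    assume nw: "\<not> w \<rightarrow>\<^sup>*\<^bsub>with_proj T\<^esub> u"
    then have uw: "u \<rightarrow>\<^sup>*\<^bsub>with_proj T\<^esub> w"
      using that u ancestors_chain[of u x w] by (auto simp: common_ancestor_def)
    then have "w \<rightarrow>\<^sup>*\<^bsub>with_proj T\<^esub> w"
      using reachable_in_verts by auto
    then have "{w. w \<rightarrow>\<^sup>*\<^bsub>with_proj T\<^esub> u} \<subset> {v. v \<rightarrow>\<^sup>*\<^bsub>with_proj T\<^esub> w}"
      using nw uw reachable_trans by blast
    then have "?d u < ?d w"
      by (intro psubset_card_mono fin)
    then show False
      using max[OF that] by simp
  qed
  with u show ?thesis by blast
qed

lemma lca_common_ancestor:
  assumes "x \<in> pverts T" "y \<in> pverts T"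
  shows "lca T x y \<rightarrow>\<^sup>*\<^bsub>with_proj T\<^esub> x" "lca T x y \<rightarrow>\<^sup>*\<^bsub>with_proj T\<^esub> y"
    and common_ancestor_lca: "w \<rightarrow>\<^sup>*\<^bsub>with_proj T\<^esub> x \<Longrightarrow> w \<rightarrow>\<^sup>*\<^bsub>with_proj T\<^esub> y \<Longrightarrow>
      w \<rightarrow>\<^sup>*\<^bsub>with_proj T\<^esub> lca T x y"
proof -
  have "\<exists>!u. common_ancestor T x y u \<and>
    (\<forall>w. common_ancestor T x y w \<longrightarrow> w \<rightarrow>\<^sup>*\<^bsub>with_proj T\<^esub> u)"
    using ex_last_common_ancestor[OF assms] by (auto intro: reachable_antisym)
  from theI'[OF this] have "common_ancestor T x y (lca T x y) \<and>
    (\<forall>w. common_ancestor T x y w \<longrightarrow> w \<rightarrow>\<^sup>*\<^bsub>with_proj T\<^esub> lca T x y)"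
    by (simp add: lca_def)
  then show "lca T x y \<rightarrow>\<^sup>*\<^bsub>with_proj T\<^esub> x" "lca T x y \<rightarrow>\<^sup>*\<^bsub>with_proj T\<^esub> y"
    and "w \<rightarrow>\<^sup>*\<^bsub>with_proj T\<^esub> x \<Longrightarrow> w \<rightarrow>\<^sup>*\<^bsub>with_proj T\<^esub> y \<Longrightarrow>
      w \<rightarrow>\<^sup>*\<^bsub>with_proj T\<^esub> lca T x y"
    by (auto simp: common_ancestor_def)
qed

lemma edge_on_lca_path_iff:
  assumes "x \<in> pverts T" "y \<in> pverts T"
  shows "(\<exists>p. apath (lca T x y) p y \<and> (\<exists>e \<in> set p. P e)) \<longleftrightarrow>
    (\<exists>u v. (u, v) \<in> parcs T \<and> P (u, v) \<and>
       v \<rightarrow>\<^sup>*\<^bsub>with_proj T\<^esub> y \<and> \<not> v \<rightarrow>\<^sup>*\<^bsub>with_proj T\<^esub> x)"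
    (is "?L \<longleftrightarrow> ?R")
proof
  assume ?L
  then obtain p e where p: "awalk (lca T x y) p y" and "e \<in> set p" "P e"
    by (auto simp: apath_def)
  then obtain p1 p2 where "p = p1 @ e # p2"
    by (meson split_list)
  with p obtain u where u: "awalk (lca T x y) p1 u" "awalk u (e # p2) y"
    by auto
  then obtain v where v: "e = (u, v)" "e \<in> parcs T" "awalk v p2 y"
    by (auto simp: awalk_Cons_iff prod_eq_iff)
  have "\<not> v \<rightarrow>\<^sup>*\<^bsub>with_proj T\<^esub> x"
  proof
    assume "v \<rightarrow>\<^sup>*\<^bsub>with_proj T\<^esub> x"
    then have "v \<rightarrow>\<^sup>*\<^bsub>with_proj T\<^esub> lca T x y"
      using common_ancestor_lca assms v(3) reachable_awalkI by blast
    then obtain q where "awalk v q (lca T x y)"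
      using reachable_awalk by auto
    then have "awalk u (e # q @ p1) u"
      using u(1) v by (auto simp: awalk_Cons_iff intro: awalk_appendI)
    moreover have "awalk u [] u"
      using u(2) awalk_hd_in_verts by (auto simp: awalk_Nil_iff)
    ultimately show False
      using awalk_unique by blast
  qed
  then show ?R
    using v \<open>P e\<close> reachable_awalkI by blast
next
  assume ?R
  then obtain u v where uv: "(u, v) \<in> parcs T" "P (u, v)"
    and vy: "v \<rightarrow>\<^sup>*\<^bsub>with_proj T\<^esub> y" and vx: "\<not> v \<rightarrow>\<^sup>*\<^bsub>with_proj T\<^esub> x"
    by blast
  have "\<not> v \<rightarrow>\<^sup>*\<^bsub>with_proj T\<^esub> lca T x y"
    using vx lca_common_ancestor(1)[OF assms] reachable_trans by blast
  then have "lca T x y \<rightarrow>\<^sup>*\<^bsub>with_proj T\<^esub> v" "lca T x y \<noteq> v"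
    using ancestors_chain[OF vy lca_common_ancestor(2)[OF assms]] by auto
  then have "lca T x y \<rightarrow>\<^sup>*\<^bsub>with_proj T\<^esub> u"
    using reachable_parent uv by blast
  then obtain p where p: "awalk (lca T x y) p u"
    using reachable_awalk by auto
  obtain q where q: "awalk v q y"
    using vy reachable_awalk by auto
  have "awalk u ((u, v) # q) y"
    using q uv in_arcsD1 by (auto simp: awalk_Cons_iff)
  then have "awalk (lca T x y) (p @ (u, v) # q) y"
    using p by (auto intro: awalk_appendI)
  then have "apath (lca T x y) (p @ (u, v) # q) y"
    by (rule awalk_imp_apath)
  then show ?L
    using uv by (intro exI[of _ "p @ (u, v) # q"]) auto
qed

end

lemma rooted_tree_iff_rooted: "rooted_tree T r \<longleftrightarrow> rooted T r"
  unfolding rooted_tree_def rooted_def rooted_axioms_def Ball_def by (rule refl)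

lemma explains_iff:
  assumes "rooted_tree T r" "Inl ` X \<subseteq> pverts T"
  shows "explains T lam X M \<epsilon> \<longleftrightarrow>
    (\<forall>x \<in> X. \<forall>y \<in> X. x \<noteq> y \<longrightarrow> (\<forall>m \<in> M. m \<in> \<epsilon> (x, y) \<longleftrightarrow>
      (\<exists>u v. (u, v) \<in> parcs T \<and> m \<in> lam (u, v) \<and>
         v \<rightarrow>\<^sup>*\<^bsub>with_proj T\<^esub> Inl y \<and> \<not> v \<rightarrow>\<^sup>*\<^bsub>with_proj T\<^esub> Inl x)))"
    (is "_ \<longleftrightarrow> ?R")
proof -
  interpret rooted T r
    using assms(1) by (simp add: rooted_tree_iff_rooted)
  have "(\<exists>p. apath (lca T (Inl x) (Inl y)) p (Inl y) \<and> (\<exists>e \<in> set p. m \<in> lam e)) \<longleftrightarrow>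
      (\<exists>u v. (u, v) \<in> parcs T \<and> m \<in> lam (u, v) \<and>
         v \<rightarrow>\<^sup>*\<^bsub>with_proj T\<^esub> Inl y \<and> \<not> v \<rightarrow>\<^sup>*\<^bsub>with_proj T\<^esub> Inl x)"
    if "x \<in> X" "y \<in> X" for x y m
    by (rule edge_on_lca_path_iff) (use assms(2) that in auto)
  note eq = this
  have "explains T lam X M \<epsilon> \<longleftrightarrow> (\<forall>x \<in> X. \<forall>y \<in> X. x \<noteq> y \<longrightarrow> (\<forall>m \<in> M. m \<in> \<epsilon> (x, y) \<longleftrightarrow>
      (\<exists>p. apath (lca T (Inl x) (Inl y)) p (Inl y) \<and> (\<exists>e \<in> set p. m \<in> lam e))))"
    unfolding explains_def irr_pairs_def by blast
  also have "\<dots> \<longleftrightarrow> ?R"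
    by (simp only: eq cong: ball_cong)
  finally show ?thesis .
qed

section \<open>Complementary neighborhoods\<close>

definition nbh :: "'a set \<Rightarrow> ('a \<times> 'a \<Rightarrow> 'c set) \<Rightarrow> 'c \<Rightarrow> 'a \<Rightarrow> 'a set" where
  "nbh X \<epsilon> m y = {x \<in> X. x = y \<or> m \<notin> \<epsilon> (x, y)}"

definition laminar_pair :: "'a set \<Rightarrow> 'a set \<Rightarrow> bool" where
  "laminar_pair A B \<longleftrightarrow> A \<inter> B = {} \<or> A \<subseteq> B \<or> B \<subseteq> A"

definition nbhs_nested :: "'a set \<Rightarrow> 'c set \<Rightarrow> ('a \<times> 'a \<Rightarrow> 'c set) \<Rightarrow> bool" where
  "nbhs_nested X M \<epsilon> \<longleftrightarrow>
     (\<forall>m \<in> M. \<forall>y \<in> X. \<forall>x \<in> nbh X \<epsilon> m y. nbh X \<epsilon> m x \<subseteq> nbh X \<epsilon> m y)"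

definition nbhs_laminar :: "'a set \<Rightarrow> 'c set \<Rightarrow> ('a \<times> 'a \<Rightarrow> 'c set) \<Rightarrow> bool" where
  "nbhs_laminar X M \<epsilon> \<longleftrightarrow>
     (\<forall>m \<in> M. \<forall>m' \<in> M. \<forall>b \<in> X. \<forall>d \<in> X. laminar_pair (nbh X \<epsilon> m b) (nbh X \<epsilon> m' d))"

lemma nbhs_imp_forbidden_subconfigurations:
  assumes nested: "nbhs_nested X M \<epsilon>" and laminar: "nbhs_laminar X M \<epsilon>"
    and "m \<in> M" "m' \<in> M" "a \<in> X" "b \<in> X" "c \<in> X" "a \<noteq> b" "a \<noteq> c" "b \<noteq> c"
    and "m \<in> \<epsilon> (c, b)" "m \<notin> \<epsilon> (a, b)"
  shows "m \<in> \<epsilon> (c, a)"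
    and "m' \<in> \<epsilon> (a, c) \<longleftrightarrow> m' \<in> \<epsilon> (b, c)"
    and "m' \<notin> \<epsilon> (c, b) \<Longrightarrow> m' \<notin> \<epsilon> (a, b)"
    and "d \<in> X \<Longrightarrow> d \<notin> {a, b, c} \<Longrightarrow> m' \<notin> \<epsilon> (b, d) \<union> \<epsilon> (c, d) \<Longrightarrow> m' \<notin> \<epsilon> (a, d)"
proof -
  have a: "a \<in> nbh X \<epsilon> m b" and b: "b \<in> nbh X \<epsilon> m b" and c: "c \<notin> nbh X \<epsilon> m b"
    using assms by (auto simp: nbh_def)
  have "c \<notin> nbh X \<epsilon> m a"
    using nested a c \<open>m \<in> M\<close> \<open>b \<in> X\<close> unfolding nbhs_nested_def by blast
  then show "m \<in> \<epsilon> (c, a)"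
    using \<open>c \<in> X\<close> by (auto simp: nbh_def)
  have sub: "nbh X \<epsilon> m b \<subseteq> nbh X \<epsilon> m' y \<or> nbh X \<epsilon> m b \<inter> nbh X \<epsilon> m' y = {}"
    if "y \<in> X" "c \<in> nbh X \<epsilon> m' y" for y
    using laminar that c assms(3,4,6) unfolding nbhs_laminar_def laminar_pair_def by blast
  show "m' \<in> \<epsilon> (a, c) \<longleftrightarrow> m' \<in> \<epsilon> (b, c)"
    using sub[of c] a b assms(5-10) by (auto simp: nbh_def)
  show "m' \<notin> \<epsilon> (a, b)" if "m' \<notin> \<epsilon> (c, b)"
    using sub[of b] a b assms(5-10) that by (auto simp: nbh_def)
  show "m' \<notin> \<epsilon> (a, d)" if "d \<in> X" "d \<notin> {a, b, c}" "m' \<notin> \<epsilon> (b, d) \<union> \<epsilon> (c, d)"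
    using sub[of d] a b assms(5-10) that by (auto simp: nbh_def)
qed

lemma nbhs_nestedI:
  assumes "\<And>m a b c. m \<in> M \<Longrightarrow> a \<in> X \<Longrightarrow> b \<in> X \<Longrightarrow> c \<in> X \<Longrightarrow>
      a \<noteq> b \<Longrightarrow> a \<noteq> c \<Longrightarrow> b \<noteq> c \<Longrightarrow> m \<in> \<epsilon> (c, b) \<Longrightarrow> m \<notin> \<epsilon> (a, b) \<Longrightarrow> m \<in> \<epsilon> (c, a)"
  shows "nbhs_nested X M \<epsilon>"
  unfolding nbhs_nested_def nbh_def using assms by auto

lemma nbhs_laminarI:
  assumes nested: "nbhs_nested X M \<epsilon>"
    and triple: "\<And>m m' a b c. m \<in> M \<Longrightarrow> m' \<in> M \<Longrightarrow> a \<in> X \<Longrightarrow> b \<in> X \<Longrightarrow> c \<in> X \<Longrightarrow>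
      a \<noteq> b \<Longrightarrow> a \<noteq> c \<Longrightarrow> b \<noteq> c \<Longrightarrow> m \<in> \<epsilon> (c, b) \<Longrightarrow> m \<notin> \<epsilon> (a, b) \<Longrightarrow>
      (m' \<in> \<epsilon> (a, c) \<longleftrightarrow> m' \<in> \<epsilon> (b, c)) \<and> (m \<noteq> m' \<and> m' \<notin> \<epsilon> (c, b) \<longrightarrow> m' \<notin> \<epsilon> (a, b))"
    and quadruple: "\<And>m m' a b c d. m \<in> M \<Longrightarrow> m' \<in> M \<Longrightarrow>
      a \<in> X \<Longrightarrow> b \<in> X \<Longrightarrow> c \<in> X \<Longrightarrow> d \<in> X \<Longrightarrow>
      a \<noteq> b \<Longrightarrow> a \<noteq> c \<Longrightarrow> b \<noteq> c \<Longrightarrow> d \<noteq> a \<Longrightarrow> d \<noteq> b \<Longrightarrow> d \<noteq> c \<Longrightarrow>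
      m \<in> \<epsilon> (c, b) \<Longrightarrow> m \<notin> \<epsilon> (a, b) \<Longrightarrow> m \<noteq> m' \<Longrightarrow> m' \<notin> \<epsilon> (b, d) \<union> \<epsilon> (c, d) \<Longrightarrow> m' \<notin> \<epsilon> (a, d)"
  shows "nbhs_laminar X M \<epsilon>"
proof -
  have center: "nbh X \<epsilon> m b \<subseteq> nbh X \<epsilon> m' d \<or> nbh X \<epsilon> m' d \<subseteq> nbh X \<epsilon> m b"
    if mem: "m \<in> M" "m' \<in> M" "b \<in> X" "d \<in> X" and bd: "b \<in> nbh X \<epsilon> m' d" for m m' b d
  proof (rule ccontr)
    assume "\<not> ?thesis"
    then obtain p q where p: "p \<in> nbh X \<epsilon> m b" "p \<notin> nbh X \<epsilon> m' d"
      and q: "q \<in> nbh X \<epsilon> m' d" "q \<notin> nbh X \<epsilon> m b"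
      by blast
    have "m \<noteq> m'"
      using nested bd mem p unfolding nbhs_nested_def by blast
    have X: "p \<in> X" "q \<in> X" and ne: "p \<noteq> b" "p \<noteq> q" "b \<noteq> q" "d \<noteq> p"
      and eps: "m \<in> \<epsilon> (q, b)" "m \<notin> \<epsilon> (p, b)" "m' \<in> \<epsilon> (p, d)"
      using p q bd mem by (auto simp: nbh_def)
    consider "d = b" | "d = q" | "d \<noteq> b" "d \<noteq> q" by blast
    then show False
    proof cases
      case 1
      then show ?thesis
        using triple[OF mem(1,2) X(1) mem(3) X(2) ne(1-3) eps(1,2)] eps q \<open>m \<noteq> m'\<close> ne
        by (auto simp: nbh_def)
    next
      case 2
      then show ?thesis
        using triple[OF mem(1,2) X(1) mem(3) X(2) ne(1-3) eps(1,2)] eps bd ne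
        by (auto simp: nbh_def)
    next
      case 3
      then show ?thesis
        using quadruple[OF mem(1,2) X(1) mem(3) X(2) mem(4) ne(1-3) _ _ _ eps(1,2)]
          eps bd q ne \<open>m \<noteq> m'\<close> by (auto simp: nbh_def)
    qed
  qed
  have "laminar_pair (nbh X \<epsilon> m b) (nbh X \<epsilon> m' d)"
    if mem: "m \<in> M" "m' \<in> M" "b \<in> X" "d \<in> X" for m m' b d
  proof -
    consider "b \<in> nbh X \<epsilon> m' d" | "d \<in> nbh X \<epsilon> m b"
      | "b \<notin> nbh X \<epsilon> m' d" "d \<notin> nbh X \<epsilon> m b" by blast
    then show ?thesis
    proof cases
      case 1
      then show ?thesis
        using center mem unfolding laminar_pair_def by blast
    next
      case 2
      then show ?thesis
        using center mem unfolding laminar_pair_def by blast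
    next
      case 3
      have False if u: "u \<in> nbh X \<epsilon> m b" "u \<in> nbh X \<epsilon> m' d" for u
      proof -
        have "u \<noteq> b" "u \<noteq> d"
          using u 3 by auto
        then show False
          using u 3 mem triple[of m m' u b d] by (auto simp: nbh_def)
      qed
      then show ?thesis
        by (auto simp: laminar_pair_def)
    qed
  qed
  then show ?thesis
    by (auto simp: nbhs_laminar_def)
qed

lemma explains_imp_nbhs:
  assumes "rooted_tree T r" "Inl ` X \<subseteq> pverts T" "explains T lam X M \<epsilon>"
  shows "nbhs_nested X M \<epsilon>" "nbhs_laminar X M \<epsilon>"
proof -
  interpret rooted T r
    using assms(1) by (simp add: rooted_tree_iff_rooted)
  define below where "below m v x \<longleftrightarrow> (\<exists>u. (u, v) \<in> parcs T \<and> m \<in> lam (u, v)) \<and>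
    v \<rightarrow>\<^sup>*\<^bsub>with_proj T\<^esub> Inl x" for m v and x :: 'a
  have nbh: "x \<in> nbh X \<epsilon> m y \<longleftrightarrow> x \<in> X \<and> (\<forall>v. below m v y \<longrightarrow> below m v x)"
    if "m \<in> M" "y \<in> X" for x y m
  proof (cases "x \<in> X \<and> x \<noteq> y")
    case True
    then have "m \<in> \<epsilon> (x, y) \<longleftrightarrow> (\<exists>u v. (u, v) \<in> parcs T \<and> m \<in> lam (u, v) \<and>
         v \<rightarrow>\<^sup>*\<^bsub>with_proj T\<^esub> Inl y \<and> \<not> v \<rightarrow>\<^sup>*\<^bsub>with_proj T\<^esub> Inl x)"
      using assms(3) that unfolding explains_iff[OF assms(1,2)] by blast
    then show ?thesis
      using True unfolding below_def nbh_def by blast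
  qed (use that in \<open>auto simp: nbh_def\<close>)
  show "nbhs_nested X M \<epsilon>"
    unfolding nbhs_nested_def using nbh by auto
  have "laminar_pair (nbh X \<epsilon> m b) (nbh X \<epsilon> m' d)"
    if mem: "m \<in> M" "m' \<in> M" "b \<in> X" "d \<in> X" for m m' b d
  proof (rule ccontr)
    assume "\<not> ?thesis"
    then obtain x p q where "x \<in> nbh X \<epsilon> m b" "x \<in> nbh X \<epsilon> m' d"
      "p \<in> nbh X \<epsilon> m b" "p \<notin> nbh X \<epsilon> m' d" "q \<notin> nbh X \<epsilon> m b" "q \<in> nbh X \<epsilon> m' d"
      unfolding laminar_pair_def by blast
    then obtain v w where vw: "\<not> below m' v p" "\<not> below m w q"
        "below m' v x" "below m w x" "below m' v q" "below m w p"
      by (auto simp: nbh mem)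
    then have "v \<rightarrow>\<^sup>*\<^bsub>with_proj T\<^esub> w \<or> w \<rightarrow>\<^sup>*\<^bsub>with_proj T\<^esub> v"
      using ancestors_chain unfolding below_def by blast
    then show False
      using vw reachable_trans unfolding below_def by blast
  qed
  then show "nbhs_laminar X M \<epsilon>"
    by (auto simp: nbhs_laminar_def)
qed

section \<open>The tree of a hierarchy\<close>

lemma (in pair_fin_digraph) rootedI:
  assumes root: "r \<in> pverts G" "\<And>u. (u, r) \<notin> parcs G"
    and parent: "\<And>u v w. (u, v) \<in> parcs G \<Longrightarrow> (w, v) \<in> parcs G \<Longrightarrow> u = w"
    and reach: "\<And>v. v \<in> pverts G \<Longrightarrow> r \<rightarrow>\<^sup>*\<^bsub>with_proj G\<^esub> v"
  shows "rooted_tree G r"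
proof -
  have "p = q" if "awalk r p v" "awalk r q v" for p q v
    using that
  proof (induction p arbitrary: q v rule: rev_induct)
    case Nil
    then have "v = r" by (simp add: awalk_Nil_iff)
    show ?case
    proof (cases q rule: rev_cases)
      case (snoc q' e)
      then obtain u where "awalk u [e] r"
        using Nil \<open>v = r\<close> by auto
      then have "(u, r) \<in> parcs G"
        by (cases e) (auto simp: awalk_simps)
      then show ?thesis using root by blast
    qed simp
  next
    case (snoc e p)
    then obtain u where u: "awalk r p u" "awalk u [e] v"
      by auto
    then have e: "e = (u, v)" "e \<in> parcs G"
      by (auto simp: awalk_simps prod_eq_iff)
    show ?case
    proof (cases q rule: rev_cases)
      case Nil
      then show ?thesis
        using snoc.prems e root by (auto simp: awalk_Nil_iff)
    next
      case (snoc q' e')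
      then obtain u' where u': "awalk r q' u'" "awalk u' [e'] v"
        using snoc.prems by auto
      then have e': "e' = (u', v)" "e' \<in> parcs G"
        by (auto simp: awalk_simps prod_eq_iff)
      then have "u' = u"
        using e parent by blast
      then show ?thesis
        using snoc.IH u u' e e' snoc by auto
    qed
  qed
  moreover have "\<exists>p. awalk r p v" if "v \<in> pverts G" for v
    using reach[OF that] reachable_awalk by auto
  ultimately show ?thesis
    using root unfolding rooted_tree_def
    by (auto intro: pair_fin_digraph_axioms)
qed

locale hierarchy =
  fixes X :: "'a set" and H :: "'a set set" and f :: "'a set \<Rightarrow> nat"
  assumes finite_X: "finite X"
    and X_in_H: "X \<in> H"
    and H_subset: "A \<in> H \<Longrightarrow> A \<subseteq> X"
    and H_nonempty: "A \<in> H \<Longrightarrow> A \<noteq> {}"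
    and singleton_in_H: "x \<in> X \<Longrightarrow> {x} \<in> H"
    and H_laminar: "A \<in> H \<Longrightarrow> B \<in> H \<Longrightarrow> laminar_pair A B"
    and inj_f: "inj_on f H"
begin

definition node :: "'a set \<Rightarrow> 'a + nat" where
  "node A = (if \<exists>x. A = {x} then Inl (the_elem A) else Inr (f A))"

definition covers :: "'a set \<Rightarrow> 'a set \<Rightarrow> bool" where
  "covers A B \<longleftrightarrow> A \<in> H \<and> B \<in> H \<and> B \<subset> A \<and> \<not> (\<exists>C \<in> H. B \<subset> C \<and> C \<subset> A)"

definition tree :: "('a + nat) pair_pre_digraph" where
  "tree = \<lparr>pverts = node ` H, parcs = {(node A, node B) |A B. covers A B}\<rparr>"

lemma pverts_tree [simp]: "pverts tree = node ` H"
  by (simp add: tree_def)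

lemma node_singleton [simp]: "node {x} = Inl x"
  by (simp add: node_def)

lemma node_eq_Inl_iff: "node A = Inl x \<longleftrightarrow> A = {x}"
  by (auto simp: node_def)

lemma node_inject: "A \<in> H \<Longrightarrow> B \<in> H \<Longrightarrow> node A = node B \<longleftrightarrow> A = B"
  using inj_f by (auto simp: node_def inj_on_def split: if_splits)

lemma finite_H: "finite H"
  using H_subset finite_X finite_subset[of H "Pow X"] by auto

lemma tree_arcE:
  assumes "(u, v) \<in> parcs tree"
  obtains A B where "u = node A" "v = node B" "covers A B" "A \<in> H" "B \<in> H"
  using assms by (auto simp: tree_def covers_def)

lemma pair_fin_digraph_tree: "pair_fin_digraph tree"
proof
  have "parcs tree \<subseteq> node ` H \<times> node ` H"
    by (auto simp: tree_def covers_def)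
  then show "finite (parcs tree)"
    using finite_H finite_subset by blast
qed (auto simp: tree_def covers_def finite_H)

sublocale pair_fin_digraph tree
  by (rule pair_fin_digraph_tree)

lemma ex_cover_above:
  assumes "A \<in> H" "B \<in> H" "B \<subset> A"
  shows "\<exists>C. covers C B \<and> C \<subseteq> A"
proof -
  have "finite {C \<in> H. B \<subset> C \<and> C \<subseteq> A}" "A \<in> {C \<in> H. B \<subset> C \<and> C \<subseteq> A}"
    using finite_H assms by auto
  from finite_has_minimal2[OF this] show ?thesis
    using assms unfolding covers_def by (smt (verit) mem_Collect_eq order.trans psubset_eq)
qed

lemma ex_cover_below:
  assumes "A \<in> H" "B \<in> H" "B \<subset> A"
  shows "\<exists>C. covers A C \<and> B \<subseteq> C"
proof -
  have "finite {C \<in> H. B \<subseteq> C \<and> C \<subset> A}" "B \<in> {C \<in> H. B \<subseteq> C \<and> C \<subset> A}"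
    using finite_H assms by auto
  from finite_has_maximal2[OF this] show ?thesis
    using assms unfolding covers_def by (smt (verit) mem_Collect_eq order.trans psubset_eq)
qed

lemma cover_unique:
  assumes "covers A B" "covers A' B"
  shows "A = A'"
proof -
  have "laminar_pair A A'" "B \<noteq> {}"
    using assms H_laminar H_nonempty by (auto simp: covers_def)
  then show ?thesis
    using assms unfolding covers_def laminar_pair_def by blast
qed

lemma subset_imp_reachable:
  assumes "A \<in> H" "B \<in> H" "B \<subseteq> A"
  shows "node A \<rightarrow>\<^sup>*\<^bsub>with_proj tree\<^esub> node B"
  using assms(2,3)
proof (induction "card (A - B)" arbitrary: B rule: less_induct)
  case less
  show ?case
  proof (cases "B = A")
    case True
    then show ?thesis
      using assms(1) by simp
  next
    case False
    then obtain C where C: "covers C B" "C \<subseteq> A"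
      using ex_cover_above[of A B] less assms(1) by auto
    then have "A - C \<subset> A - B"
      by (auto simp: covers_def)
    moreover have "finite (A - B)"
      using assms(1) H_subset finite_X finite_subset by blast
    ultimately have "card (A - C) < card (A - B)"
      by (simp add: psubset_card_mono)
    then have "node A \<rightarrow>\<^sup>*\<^bsub>with_proj tree\<^esub> node C"
      using less.hyps C by (auto simp: covers_def)
    moreover have "(node C, node B) \<in> parcs tree"
      using C by (auto simp: tree_def)
    ultimately show ?thesis
      by (auto intro: reachable_adj_trans)
  qed
qed

lemma reachable_imp_subset:
  assumes "u \<rightarrow>\<^sup>*\<^bsub>with_proj tree\<^esub> v"
  shows "\<exists>A B. A \<in> H \<and> B \<in> H \<and> u = node A \<and> v = node B \<and> B \<subseteq> A"
  using assms
proof (induction rule: reachable_induct)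
  case base
  then show ?case by (auto simp: tree_def)
next
  case (step v w)
  then obtain A B where "A \<in> H" "B \<in> H" "u = node A" "v = node B" "B \<subseteq> A"
    by blast
  moreover obtain B' C where "v = node B'" "w = node C" "covers B' C"
    using step tree_arcE by (metis with_proj_simps(3))
  ultimately show ?case
    by (metis covers_def node_inject order.trans psubset_imp_subset)
qed

lemma reachable_iff:
  assumes "A \<in> H" "B \<in> H"
  shows "node A \<rightarrow>\<^sup>*\<^bsub>with_proj tree\<^esub> node B \<longleftrightarrow> B \<subseteq> A"
  using assms subset_imp_reachable reachable_imp_subset node_inject by metis

lemma rooted_tree_tree: "rooted_tree tree (node X)"
proof (rule rootedI)
  show "node X \<in> pverts tree"
    using X_in_H by (simp add: tree_def)
  show "(u, node X) \<notin> parcs tree" for u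
    using X_in_H H_subset by (metis covers_def leD node_inject tree_arcE)
  show "u = w" if "(u, v) \<in> parcs tree" "(w, v) \<in> parcs tree" for u v w
    using that by (elim tree_arcE) (metis cover_unique node_inject)
  show "node X \<rightarrow>\<^sup>*\<^bsub>with_proj tree\<^esub> v" if "v \<in> pverts tree" for v
    using that subset_imp_reachable X_in_H H_subset by (auto simp: tree_def)
qed

lemma in_degree_node:
  assumes "A \<in> H" "A \<noteq> X"
  shows "in_degree (with_proj tree) (node A) = 1"
proof -
  obtain C where C: "covers C A"
    using ex_cover_above[of X A] assms H_subset X_in_H by auto
  have "u = node C" if "(u, node A) \<in> parcs tree" for u
    using that C assms(1) by (metis tree_arcE cover_unique node_inject)
  moreover have "(node C, node A) \<in> parcs tree"
    using C by (auto simp: tree_def)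
  ultimately have "e \<in> in_arcs (with_proj tree) (node A) \<longleftrightarrow> e = (node C, node A)" for e
    by (metis in_in_arcs_conv prod.collapse snd_conv with_proj_simps(2,5))
  then have "in_arcs (with_proj tree) (node A) = {(node C, node A)}"
    by blast
  then show ?thesis
    by (simp add: in_degree_def)
qed

lemma out_degree_singleton: "out_degree (with_proj tree) (Inl x) = 0"
proof -
  have "out_arcs (with_proj tree) (Inl x) = {}"
    using H_nonempty node_eq_Inl_iff
    by (auto simp: out_arcs_def elim!: tree_arcE) (metis covers_def psubset_eq subset_singletonD)
  then show ?thesis
    by (simp add: out_degree_def)
qed

lemma out_degree_node:
  assumes "A \<in> H" "\<nexists>x. A = {x}"
  shows "2 \<le> out_degree (with_proj tree) (node A)"
proof -
  obtain x where x: "x \<in> A"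
    using H_nonempty assms by blast
  then have "{x} \<subset> A" "{x} \<in> H"
    using assms H_subset singleton_in_H by auto
  then obtain B where B: "covers A B" "{x} \<subseteq> B"
    using ex_cover_below assms(1) by blast
  then obtain y where y: "y \<in> A" "y \<notin> B"
    by (auto simp: covers_def)
  then have "{y} \<subset> A" "{y} \<in> H"
    using assms H_subset singleton_in_H by auto
  then obtain C where C: "covers A C" "{y} \<subseteq> C"
    using ex_cover_below assms(1) by blast
  have "B \<in> H" "C \<in> H" "B \<noteq> C"
    using B C y by (auto simp: covers_def)
  then have "card {(node A, node B), (node A, node C)} = 2"
    by (simp add: node_inject)
  moreover have "{(node A, node B), (node A, node C)} \<subseteq> out_arcs (with_proj tree) (node A)"
    using B C by (auto simp: tree_def)
  ultimately show ?thesis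
    unfolding out_degree_def by (metis card_mono finite_out_arcs)
qed

lemma phylogenetic_tree_tree: "phylogenetic_tree tree (node X) (Inl ` X)"
proof (cases "\<exists>x. X = {x}")
  case True
  then obtain x where x: "X = {x}" by blast
  then have "H = {{x}}"
    using H_subset H_nonempty X_in_H by fastforce
  then have "node ` H = {node X}"
    using x by simp
  then have "pverts tree = {node X}"
    by (simp only: pverts_tree)
  then show ?thesis
    using x rooted_tree_tree by (simp add: phylogenetic_tree_def)
next
  case False
  have inner: "3 \<le> degree tree (node A)" if "A \<in> H" "A \<noteq> X" "\<nexists>x. A = {x}" for A
    using in_degree_node out_degree_node that by (fastforce simp: degree_def)
  have leaf: "degree tree (Inl x) = 1" if "x \<in> X" for x
    using in_degree_node[of "{x}"] out_degree_singleton[of x] False that singleton_in_H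
    by (auto simp: degree_def)
  have "leaves tree (node X) = Inl ` X"
  proof (intro set_eqI iffI)
    fix v assume "v \<in> leaves tree (node X)"
    then obtain A where A: "A \<in> H" "v = node A" "A \<noteq> X" "degree tree (node A) = 1"
      by (auto simp: leaves_def tree_def)
    then obtain x where "A = {x}"
      using inner by fastforce
    then show "v \<in> Inl ` X"
      using A H_subset by auto
  next
    fix v :: "'a + nat" assume "v \<in> Inl ` X"
    then obtain x where x: "x \<in> X" "v = node {x}"
      by auto
    then have "v \<in> pverts tree" "v \<noteq> node X"
      using singleton_in_H X_in_H False by (auto simp: tree_def node_inject simp del: node_singleton)
    then show "v \<in> leaves tree (node X)"
      using x leaf by (auto simp: leaves_def)
  qed
  moreover have "2 \<le> degree tree (node X)"
    using out_degree_node[OF X_in_H] False by (auto simp: degree_def)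
  moreover have "3 \<le> degree tree v" if v: "v \<in> pverts tree - Inl ` X - {node X}" for v
  proof -
    obtain A where A: "A \<in> H" "v = node A" "A \<noteq> X"
      using v by auto
    moreover have "\<nexists>x. A = {x}"
      using A v H_subset[of A] by auto
    ultimately show ?thesis
      using inner by blast
  qed
  ultimately show ?thesis
    using rooted_tree_tree by (simp add: phylogenetic_tree_def)
qed

end

lemma nbhs_imp_fitch_map:
  assumes "finite X" "X \<noteq> {}" and nested: "nbhs_nested X M \<epsilon>" and laminar: "nbhs_laminar X M \<epsilon>"
  shows "fitch_map X M \<epsilon>"
proof -
  let ?N = "nbh X \<epsilon>"
  define H where "H = {X} \<union> (\<lambda>x. {x}) ` X \<union> {?N m y |m y. m \<in> M \<and> y \<in> X}"
  have "H \<subseteq> Pow X"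
    by (auto simp: H_def nbh_def)
  then have "finite H"
    using assms(1) finite_subset by blast
  then obtain f :: "'a set \<Rightarrow> nat" where f: "inj_on f H"
    by (meson finite_imp_inj_to_nat_seg)
  have self: "y \<in> ?N m y" if "y \<in> X" for m y
    using that by (simp add: nbh_def)
  interpret hierarchy X H f
  proof
    show "laminar_pair A B" if "A \<in> H" "B \<in> H" for A B
    proof -
      have "C = X \<or> (\<exists>x. C = {x}) \<or> (\<exists>m \<in> M. \<exists>y \<in> X. C = ?N m y)" if "C \<in> H" for C
        using that unfolding H_def by blast
      then have "A = X \<or> B = X \<or> (\<exists>x. A = {x}) \<or> (\<exists>x. B = {x}) \<or> laminar_pair A B"
        using \<open>A \<in> H\<close> \<open>B \<in> H\<close> laminar unfolding nbhs_laminar_def by metis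
      moreover have "A \<subseteq> X" "B \<subseteq> X"
        using \<open>A \<in> H\<close> \<open>B \<in> H\<close> \<open>H \<subseteq> Pow X\<close> by auto
      ultimately show ?thesis
        by (auto simp: laminar_pair_def)
    qed
    show "A \<subseteq> X" if "A \<in> H" for A
      using that \<open>H \<subseteq> Pow X\<close> by blast
    show "A \<noteq> {}" if "A \<in> H" for A
      using that \<open>X \<noteq> {}\<close> self unfolding H_def by blast
  qed (use assms(1) f in \<open>simp_all add: H_def\<close>)
  define lam where "lam e = {m \<in> M. \<exists>z \<in> X. snd e = node (?N m z)}" for e :: "('a + nat) \<times> ('a + nat)"
  have N_in_H: "?N m z \<in> H" if "m \<in> M" "z \<in> X" for m z
    using that by (auto simp: H_def)
  have iff: "m \<in> \<epsilon> (x, y) \<longleftrightarrow> (\<exists>u v. (u, v) \<in> parcs tree \<and> m \<in> lam (u, v) \<and>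
      v \<rightarrow>\<^sup>*\<^bsub>with_proj tree\<^esub> Inl y \<and> \<not> v \<rightarrow>\<^sup>*\<^bsub>with_proj tree\<^esub> Inl x)"
    (is "_ \<longleftrightarrow> ?R")
    if mem: "x \<in> X" "y \<in> X" "x \<noteq> y" "m \<in> M" for x y m
  proof -
    have reach: "node A \<rightarrow>\<^sup>*\<^bsub>with_proj tree\<^esub> Inl z \<longleftrightarrow> z \<in> A" if "A \<in> H" "z \<in> X" for A z
      using reachable_iff[of A "{z}"] that singleton_in_H by simp
    have eps: "m \<in> \<epsilon> (x, y) \<longleftrightarrow> x \<notin> ?N m y"
      using mem by (simp add: nbh_def)
    show ?thesis
    proof
      assume "m \<in> \<epsilon> (x, y)"
      then have x: "x \<notin> ?N m y"
        using eps by blast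
      then have "?N m y \<subset> X"
        using mem N_in_H H_subset by blast
      then obtain C where C: "covers C (?N m y)"
        using ex_cover_above X_in_H N_in_H mem by blast
      then have "(node C, node (?N m y)) \<in> parcs tree"
        by (auto simp: tree_def)
      moreover have "m \<in> lam (node C, node (?N m y))"
        using mem by (auto simp: lam_def)
      ultimately show ?R
        using reach[OF N_in_H] mem x self by blast
    next
      assume ?R
      then obtain v z where "z \<in> X" and v: "v = node (?N m z)" "v \<rightarrow>\<^sup>*\<^bsub>with_proj tree\<^esub> Inl y"
        "\<not> v \<rightarrow>\<^sup>*\<^bsub>with_proj tree\<^esub> Inl x"
        by (auto simp: lam_def)
      then have "y \<in> ?N m z" "x \<notin> ?N m z"
        using reach[OF N_in_H] mem by auto
      then have "x \<notin> ?N m y"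
        using nested mem \<open>z \<in> X\<close> unfolding nbhs_nested_def by blast
      then show "m \<in> \<epsilon> (x, y)"
        using eps by blast
    qed
  qed
  have "Inl ` X \<subseteq> pverts tree"
    using singleton_in_H by (force simp: tree_def simp flip: node_singleton)
  then have "explains tree lam X M \<epsilon>"
    using iff by (simp add: explains_iff[OF rooted_tree_tree])
  moreover have "edge_labeled_tree tree (node X) lam (Inl ` X) M"
    using phylogenetic_tree_tree by (auto simp: edge_labeled_tree_def lam_def)
  ultimately show ?thesis
    unfolding fitch_map_def by blast
qed

lemma fitch_map_iff_nbhs:
  assumes "finite X" "X \<noteq> {}"
  shows "fitch_map X M \<epsilon> \<longleftrightarrow> nbhs_nested X M \<epsilon> \<and> nbhs_laminar X M \<epsilon>"
proof
  assume "fitch_map X M \<epsilon>"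
  then obtain T r lam where "phylogenetic_tree T r (Inl ` X)" and ex: "explains T lam X M \<epsilon>"
    by (auto simp: fitch_map_def edge_labeled_tree_def)
  then have T: "rooted_tree T r" "Inl ` X \<subseteq> pverts T"
    by (auto simp: phylogenetic_tree_def leaves_def)
  show "nbhs_nested X M \<epsilon> \<and> nbhs_laminar X M \<epsilon>"
    using explains_imp_nbhs[OF T ex] ..
qed (use assms nbhs_imp_fitch_map in blast)

lemma card_eq_3_iff: "card {a, b, c} = 3 \<longleftrightarrow> a \<noteq> b \<and> a \<noteq> c \<and> b \<noteq> c"
  by (auto simp: card_insert_if)

lemma card_eq_4_iff: "card {a, b, c, d} = 4 \<longleftrightarrow>
    a \<noteq> b \<and> a \<noteq> c \<and> b \<noteq> c \<and> d \<noteq> a \<and> d \<noteq> b \<and> d \<noteq> c"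
  by (auto simp: card_insert_if)

theorem theorem2:
  fixes X :: "'a set" and M :: "'c set" and \<epsilon> :: "'a \<times> 'a \<Rightarrow> 'c set"
  assumes "finite X" and "X \<noteq> {}" and "finite M" and "M \<noteq> {}"
    and "\<epsilon> \<in> irr_pairs X \<rightarrow> Pow M"
  shows "fitch_map X M \<epsilon> \<longleftrightarrow>
    (\<forall>m \<in> M. \<forall>m' \<in> M.
      (\<forall>a b c. {a, b, c} \<subseteq> X \<and> card {a, b, c} = 3 \<and> m \<in> \<epsilon> (c, b) \<and> m \<notin> \<epsilon> (a, b) \<longrightarrow>
         m \<in> \<epsilon> (c, a) \<and>
         (m' \<in> \<epsilon> (a, c) \<longleftrightarrow> m' \<in> \<epsilon> (b, c)) \<and>
         (m \<noteq> m' \<and> m' \<notin> \<epsilon> (c, b) \<longrightarrow> m' \<notin> \<epsilon> (a, b))) \<and>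
      (\<forall>a b c d. {a, b, c, d} \<subseteq> X \<and> card {a, b, c, d} = 4 \<and> m \<in> \<epsilon> (c, b) \<and> m \<notin> \<epsilon> (a, b) \<longrightarrow>
         (m \<noteq> m' \<and> m' \<notin> \<epsilon> (b, d) \<union> \<epsilon> (c, d) \<longrightarrow> m' \<notin> \<epsilon> (a, d))))"
    (is "_ \<longleftrightarrow> ?R")
  unfolding fitch_map_iff_nbhs[OF assms(1,2)]
proof (intro iffI)
  assume nbhs: "nbhs_nested X M \<epsilon> \<and> nbhs_laminar X M \<epsilon>"
  note forbidden = nbhs_imp_forbidden_subconfigurations
    [OF nbhs[THEN conjunct1] nbhs[THEN conjunct2]]
  show ?R
  proof (intro ballI conjI allI impI, goal_cases)
    case (1 m m' a b c)
    then show ?case by (intro forbidden(1)[of m m' a b c]) (auto simp: card_eq_3_iff)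
  next
    case (2 m m' a b c)
    then show ?case by (intro forbidden(2)[of m m' a b c]) (auto simp: card_eq_3_iff)
  next
    case (3 m m' a b c)
    then show ?case by (intro forbidden(3)[of m m' a b c]) (auto simp: card_eq_3_iff)
  next
    case (4 m m' a b c d)
    then show ?case by (intro forbidden(4)[of m m' a b c]) (auto simp: card_eq_4_iff)
  qed
next
  assume R: ?R
  have triple: "m \<in> \<epsilon> (c, a) \<and> (m' \<in> \<epsilon> (a, c) \<longleftrightarrow> m' \<in> \<epsilon> (b, c)) \<and>
      (m \<noteq> m' \<and> m' \<notin> \<epsilon> (c, b) \<longrightarrow> m' \<notin> \<epsilon> (a, b))"
    if "m \<in> M" "m' \<in> M" "a \<in> X" "b \<in> X" "c \<in> X" "a \<noteq> b" "a \<noteq> c" "b \<noteq> c"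
      "m \<in> \<epsilon> (c, b)" "m \<notin> \<epsilon> (a, b)" for m m' a b c
    by (rule R[rule_format, THEN conjunct1, rule_format]) (use that in \<open>auto simp: card_eq_3_iff\<close>)
  have quadruple: "m' \<notin> \<epsilon> (a, d)"
    if "m \<in> M" "m' \<in> M" "a \<in> X" "b \<in> X" "c \<in> X" "d \<in> X"
      "a \<noteq> b" "a \<noteq> c" "b \<noteq> c" "d \<noteq> a" "d \<noteq> b" "d \<noteq> c"
      "m \<in> \<epsilon> (c, b)" "m \<notin> \<epsilon> (a, b)" "m \<noteq> m'" "m' \<notin> \<epsilon> (b, d) \<union> \<epsilon> (c, d)" for m m' a b c d
    by (rule R[THEN bspec[of M _ m], THEN bspec[of M _ m'], THEN conjunct2,
          THEN spec[of _ a], THEN spec[of _ b], THEN spec[of _ c], THEN spec[of _ d], THEN mp, THEN mp])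
      (use that in \<open>auto simp: card_eq_4_iff\<close>)
  have nested: "nbhs_nested X M \<epsilon>"
    using triple by (rule nbhs_nestedI[OF conjunct1])
  then show "nbhs_nested X M \<epsilon> \<and> nbhs_laminar X M \<epsilon>"
    using nbhs_laminarI[OF nested conjunct2[OF triple] quadruple] by simp
qed

end
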